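(* Let $\Delta$ be a unit-interval simplicial complex on $[n]$ with $\dim(\Delta)=d-1>1$, and let $\Gamma=\mathrm{Ind}(\Delta)$. Let $B_1,\dots,B_m$ be the maximal cliques of $\Delta$ and suppose that they form a partition of the vertex set $V(\Delta)=[n]$. For $i\in[n]$ let $P_i=(\mathbf{x}_Ft:F\in\Gamma,\ i\notin F)\subset R_\Gamma$, and for $j\in[m]$ let $L_j=(\mathbf{x}_Ft:F\in\Gamma,\ |F\cap B_j|<d-1)\subset R_\Gamma$. Then the set $\mathcal P_\Gamma$ of height one monomial prime ideals of $R_\Gamma$ containing $t$ is $$\mathcal P_\Gamma=\{P_i:i=1,\dots,n\}\cup\{L_j:j=1,\dots,m\}.$$
   Context: For a pure $(d-1)$-dimensional simplicial complex $\Delta$ on vertex set $[n]$: a clique is a subset $C\subseteq[n]$ all of whose $d$-subsets are facets of $\Delta$; $\mathrm{Ind}(\Delta)$ is the simplicial complex of all subsets of $[n]$ containing no facet of $\Delta$. $\Delta$ is a unit-interval simplicial complex if it is pure and for every facet $\{i_1<\cdots<i_d\}$ the interval $[i_1,i_d]=\{i_1,i_1+1,\dots,i_d\}$ is a clique of $\Delta$. "Maximal cliques of $\Delta$" means the inclusion-maximal cliques with at least $d$ elements; these are intervals. Let $K$ be a field, $S=K[x_1,\dots,x_n]$, $\mathbf{x}_F=\prod_{i\in F}x_i$ ($\mathbf{x}_\emptyset=1$), and $R_\Gamma=K[\mathbf{x}_Ft:F\in\Gamma]\subset S[t]$, which is a normal Cohen-Macaulay domain. A monomial ideal of $R_\Gamma$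 is an ideal generated by monomials $x_1^{a_1}\cdots x_n^{a_n}t^k\in R_\Gamma$. *)

theory Defs
  imports
    "HOL-Algebra.Generated_Rings"
    "HOL-Algebra.Algebraic_Closure_Type"
    "HOL-Library.Poly_Mapping"
    "HOL-Library.Extended_Nat"
    "HOL-Library.Disjoint_Sets"
    "HOL-Computational_Algebra.Polynomial"
begin

definition simplicial_complex :: "nat \<Rightarrow> nat set set \<Rightarrow> bool" where
  "simplicial_complex n \<Delta> \<longleftrightarrow>
     \<Delta> \<noteq> {} \<and> \<Union>\<Delta> = {1..n} \<and> (\<forall>F\<in>\<Delta>. \<forall>G. G \<subseteq> F \<longrightarrow> G \<in> \<Delta>)"

definition facets :: "nat set set \<Rightarrow> nat set set" where
  "facets \<Delta> = {F \<in> \<Delta>. \<forall>G\<in>\<Delta>. F \<subseteq> G \<longrightarrow> F = G}"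

text \<open>Integer-valued, so that the complex \<open>{{}}\<close> has dimension \<open>-1\<close>.\<close>

definition complex_dim :: "nat set set \<Rightarrow> int" where
  "complex_dim \<Delta> = Max ((\<lambda>F. int (card F) - 1) ` \<Delta>)"

definition pure_complex :: "nat set set \<Rightarrow> bool" where
  "pure_complex \<Delta> \<longleftrightarrow> (\<forall>F\<in>facets \<Delta>. int (card F) - 1 = complex_dim \<Delta>)"

text \<open>In the following definitions \<open>d\<close> is the common cardinality of the facets of \<open>\<Delta>\<close>.\<close>

definition is_clique :: "nat \<Rightarrow> nat \<Rightarrow> nat set set \<Rightarrow> nat set \<Rightarrow> bool" where
  "is_clique n d \<Delta> C \<longleftrightarrow>
     C \<subseteq> {1..n} \<and> (\<forall>F. F \<subseteq> C \<and> card F = d \<longrightarrow> F \<in> facets \<Delta>)"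

definition maximal_cliques :: "nat \<Rightarrow> nat \<Rightarrow> nat set set \<Rightarrow> nat set set" where
  "maximal_cliques n d \<Delta> =
     {C. is_clique n d \<Delta> C \<and> d \<le> card C \<and>
         (\<forall>C'. is_clique n d \<Delta> C' \<and> C \<subseteq> C' \<longrightarrow> C = C')}"

definition Ind :: "nat \<Rightarrow> nat set set \<Rightarrow> nat set set" where
  "Ind n \<Delta> = {A. A \<subseteq> {1..n} \<and> \<not> (\<exists>F\<in>facets \<Delta>. F \<subseteq> A)}"

definition unit_interval_complex :: "nat \<Rightarrow> nat \<Rightarrow> nat set set \<Rightarrow> bool" where
  "unit_interval_complex n d \<Delta> \<longleftrightarrow>
     simplicial_complex n \<Delta> \<and> pure_complex \<Delta> \<and> complex_dim \<Delta> = int d - 1 \<and>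
     (\<forall>F\<in>facets \<Delta>. is_clique n d \<Delta> {Min F..Max F})"


text \<open>
  \<open>'k mpoly\<close> is the polynomial ring over \<open>'k\<close> in variables indexed by \<open>nat\<close>; only the
  variables with index in \<open>{1..n}\<close> occur in the rings below.  The variable \<open>t\<close> is the
  indeterminate of \<open>'k mpoly poly\<close>, so this type plays the role of \<open>S[t]\<close>.
\<close>

type_synonym 'k mpoly = "(nat \<Rightarrow>\<^sub>0 nat) \<Rightarrow>\<^sub>0 'k"

definition mvar :: "nat \<Rightarrow> 'k::field mpoly" where
  "mvar i = Poly_Mapping.single (Poly_Mapping.single i 1) 1"

definition xFt :: "nat set \<Rightarrow> 'k::field mpoly poly" where
  "xFt F = Polynomial.monom (\<Prod>i\<in>F. mvar i) 1"

definition scalars :: "'k::field mpoly poly set" where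
  "scalars = range (\<lambda>c. [:Poly_Mapping.single 0 c:])"

text \<open>A subring containing the scalars is the same as a \<open>'k\<close>-subalgebra.\<close>

definition toric_ring :: "nat set set \<Rightarrow> 'k::field mpoly poly ring" where
  "toric_ring \<Gamma> =
     ring_of_type_algebra\<lparr>carrier := generate_ring ring_of_type_algebra (scalars \<union> xFt ` \<Gamma>)\<rparr>"

definition monomials :: "nat \<Rightarrow> 'k::field mpoly poly set" where
  "monomials n = {Polynomial.monom (\<Prod>i\<in>{1..n}. mvar i ^ a i) k | a k. True}"

definition monomial_ideal :: "nat \<Rightarrow> nat set set \<Rightarrow> 'k::field mpoly poly set \<Rightarrow> bool" where
  "monomial_ideal n \<Gamma> I \<longleftrightarrow>
     (\<exists>M \<subseteq> monomials n \<inter> carrier (toric_ring \<Gamma>). I = Idl\<^bsub>toric_ring \<Gamma>\<^esub> M)"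

definition height :: "('a, 'b) ring_scheme \<Rightarrow> 'a set \<Rightarrow> enat" where
  "height R P = Sup {enat l | l. \<exists>Q :: nat \<Rightarrow> 'a set.
     (\<forall>i\<le>l. primeideal (Q i) R) \<and> (\<forall>i<l. Q i \<subset> Q (Suc i)) \<and> Q l = P}"

text \<open>Below, \<open>xFt {}\<close> is the element \<open>t\<close>.\<close>

definition height_one_monomial_primes ::
    "nat \<Rightarrow> nat set set \<Rightarrow> 'k::field mpoly poly set set" where
  "height_one_monomial_primes n \<Gamma> =
     {P. primeideal P (toric_ring \<Gamma>) \<and> height (toric_ring \<Gamma>) P = 1 \<and>
         monomial_ideal n \<Gamma> P \<and> xFt {} \<in> P}"

definition P_ideal :: "nat set set \<Rightarrow> nat \<Rightarrow> 'k::field mpoly poly set" where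
  "P_ideal \<Gamma> i = Idl\<^bsub>toric_ring \<Gamma>\<^esub> {xFt F | F. F \<in> \<Gamma> \<and> i \<notin> F}"

definition L_ideal :: "nat set set \<Rightarrow> nat \<Rightarrow> nat set \<Rightarrow> 'k::field mpoly poly set" where
  "L_ideal \<Gamma> d B = Idl\<^bsub>toric_ring \<Gamma>\<^esub> {xFt F | F. F \<in> \<Gamma> \<and> card (F \<inter> B) < d - 1}"

end

theory Submission
  imports Defs "HOL-Library.Product_Plus"
begin

text \<open>
  The facets of \<open>\<Delta>\<close> are the \<open>d\<close>-subsets of the blocks \<open>B\<^sub>j\<close>, so a monomial \<open>x\<^sup>a t\<^sup>k\<close> lies in \<open>R\<^sub>\<Gamma>\<close> iff
  \<open>0 \<le> a\<^sub>i \<le> k\<close> for all \<open>i\<close> and the sum of \<open>a\<close> over \<open>B\<^sub>j\<close> is at most \<open>(d - 1) k\<close> for all \<open>j\<close>.  The ideals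
  \<open>P\<^sub>i\<close> and \<open>L\<^sub>j\<close> are spanned by the monomials on which the form \<open>k - a\<^sub>i\<close>, respectively \<open>(d - 1) k\<close> minus
  the sum of \<open>a\<close> over \<open>B\<^sub>j\<close>, is positive.  Such an ideal is prime, and it has height one because
  localizing at it yields a discrete valuation ring whose valuation is given by the form.
  Conversely, if a prime containing \<open>t\<close> contained none of these ideals, a product of monomials outside
  it would be positive on all the forms; a high enough power of it is divisible by \<open>t\<close>, a contradiction.
\<close>

section \<open>Supports of polynomials\<close>

text \<open>\<open>(a, k)\<close> is the exponent of the monomial \<open>x\<^sup>a t\<^sup>k\<close>.\<close>

type_synonym expo = "(nat \<Rightarrow>\<^sub>0 nat) \<times> nat"

definition mterm :: "'k::field \<Rightarrow> expo \<Rightarrow> 'k mpoly poly" where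
  "mterm c h = Polynomial.monom (Poly_Mapping.single (fst h) c) (snd h)"

definition exponents :: "'k::field mpoly poly \<Rightarrow> expo set" where
  "exponents f = {h. Poly_Mapping.lookup (Polynomial.coeff f (snd h)) (fst h) \<noteq> 0}"

text \<open>The K-span of the monomials with exponent in \<open>A\<close>; the subrings and ideals
  below are all given in this form.\<close>

definition supported :: "expo set \<Rightarrow> 'k::field mpoly poly set" where
  "supported A = {f. exponents f \<subseteq> A}"

lemma mterm_mult: "mterm c g * mterm d h = mterm (c * d) (g + h)"
  by (simp add: mterm_def Polynomial.mult_monom mult_single)

lemma mterm_0_left [simp]: "mterm 0 h = 0"
  by (simp add: mterm_def)

lemma mterm_1_0: "mterm 1 0 = 1"
  by (simp add: mterm_def)

lemma exponents_mterm: "c \<noteq> 0 \<Longrightarrow> exponents (mterm c h) = {h}"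
  by (auto simp: exponents_def mterm_def lookup_single when_def prod_eq_iff split: if_splits)

lemma mterm_eq_0_iff [simp]: "mterm c h = 0 \<longleftrightarrow> c = 0"
  using exponents_mterm[of c h] by (cases "c = 0") (auto simp: exponents_def)

lemma exponents_eq_empty_iff: "exponents f = {} \<longleftrightarrow> f = 0"
proof
  assume "exponents f = {}"
  then have "Poly_Mapping.lookup (Polynomial.coeff f k) a = 0" for k a
    by (auto simp: exponents_def)
  then show "f = 0"
    by (intro Polynomial.poly_eqI poly_mapping_eqI) simp
qed (simp add: exponents_def)

lemma exponents_add: "exponents (f + g) \<subseteq> exponents f \<union> exponents g"
  by (auto simp: exponents_def lookup_add)

lemma exponents_uminus [simp]: "exponents (- f) = exponents f"
  by (simp add: exponents_def)

lemma finite_exponents: "finite (exponents f)"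
proof (rule finite_subset)
  show "exponents f \<subseteq> (\<Union>k\<le>Polynomial.degree f. Poly_Mapping.keys (Polynomial.coeff f k) \<times> {k})"
  proof
    fix h assume h: "h \<in> exponents f"
    then have "Polynomial.coeff f (snd h) \<noteq> 0" by (auto simp: exponents_def)
    then have "snd h \<le> Polynomial.degree f" by (rule le_degree)
    then show "h \<in> (\<Union>k\<le>Polynomial.degree f. Poly_Mapping.keys (Polynomial.coeff f k) \<times> {k})"
      using h by (cases h) (auto simp: exponents_def in_keys_iff)
  qed
qed auto

lemma supported_0 [simp]: "0 \<in> supported A"
  by (simp add: supported_def exponents_def)

lemma supported_add: "f \<in> supported A \<Longrightarrow> g \<in> supported A \<Longrightarrow> f + g \<in> supported A"
  using exponents_add[of f g] by (auto simp: supported_def)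

lemma supported_uminus: "f \<in> supported A \<Longrightarrow> - f \<in> supported A"
  by (simp add: supported_def)

lemma supported_diff: "f \<in> supported A \<Longrightarrow> g \<in> supported A \<Longrightarrow> f - g \<in> supported A"
  using supported_add[OF _ supported_uminus, of f A g] by simp

lemma supported_mono: "A \<subseteq> A' \<Longrightarrow> supported A \<subseteq> supported A'"
  by (auto simp: supported_def)

lemma supported_disjoint: "f \<in> supported A \<Longrightarrow> f \<in> supported A' \<Longrightarrow> A \<inter> A' = {} \<Longrightarrow> f = 0"
  unfolding supported_def using exponents_eq_empty_iff[of f] by auto

lemma mterm_supported: "h \<in> A \<Longrightarrow> mterm c h \<in> supported A"
  by (cases "c = 0") (auto simp: supported_def exponents_mterm exponents_eq_empty_iff[THEN iffD2])

lemma mterm_supported_iff: "c \<noteq> 0 \<Longrightarrow> mterm c h \<in> supported A \<longleftrightarrow> h \<in> A"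
  by (simp add: supported_def exponents_mterm)

text \<open>Induction on the number of exponents: cancelling one term removes exactly its exponent.
  This reduces linear statements about elements to single terms.\<close>

lemma supported_induct [consumes 1, case_names zero add]:
  assumes "f \<in> supported A" and zero: "P 0"
    and add: "\<And>f c h. f \<in> supported A \<Longrightarrow> P f \<Longrightarrow> h \<in> A \<Longrightarrow> P (f + mterm c h)"
  shows "P f"
proof -
  have "exponents f \<subseteq> A \<Longrightarrow> P f"
  proof (induction "card (exponents f)" arbitrary: f)
    case 0
    then show ?case using zero by (simp add: finite_exponents exponents_eq_empty_iff)
  next
    case (Suc k)
    then obtain h where h: "h \<in> exponents f"
      by (metis Suc_neq_Zero card_eq_0_iff ex_in_conv)
    define c where "c = Poly_Mapping.lookup (Polynomial.coeff f (snd h)) (fst h)"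
    define g where "g = f + mterm (- c) h"
    have g: "exponents g = exponents f - {h}"
      by (auto simp: g_def exponents_def mterm_def c_def lookup_add lookup_single when_def
          prod_eq_iff split: if_splits)
    have "mterm (- c) h + mterm c h = 0"
      by (simp add: mterm_def Polynomial.add_monom flip: single_add)
    then have f: "f = g + mterm c h"
      by (simp add: g_def add.assoc)
    have "P g"
      by (rule Suc.hyps(1)) (use Suc.hyps(2) Suc.prems g h finite_exponents[of f] in auto)
    then show ?case
      unfolding f by (intro add) (use Suc.prems g h in \<open>auto simp: supported_def\<close>)
  qed
  then show ?thesis using assms(1) by (simp add: supported_def)
qed

lemma supported_mult:
  assumes "f \<in> supported A" "g \<in> supported A'" and AC: "\<And>a b. a \<in> A \<Longrightarrow> b \<in> A' \<Longrightarrow> a + b \<in> C"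
  shows "f * g \<in> supported C"
  using assms(1)
proof (induction rule: supported_induct)
  case (add f c h)
  have "mterm c h * g \<in> supported C"
    using assms(2)
    by (induction rule: supported_induct)
      (simp_all add: distrib_left mterm_mult supported_add mterm_supported AC add.hyps)
  then show ?case using add.IH by (simp add: distrib_right supported_add)
qed simp

text \<open>Serves to cut an element along the values of a form. Terms whose exponent lies in both
  sets go to the first summand.\<close>

lemma supported_split:
  assumes "f \<in> supported (A \<union> A')"
  obtains g h where "g \<in> supported A" "h \<in> supported A'" "f = g + h"
proof -
  have "\<exists>g\<in>supported A. \<exists>h\<in>supported A'. f = g + h"
    using assms
  proof (induction rule: supported_induct)
    case zero
    then show ?case by (auto intro!: bexI[of _ 0])
  next
    case (add f c e)
    then obtain g h where gh: "g \<in> supported A" "h \<in> supported A'" "f = g + h" by blast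
    show ?case
    proof (cases "e \<in> A")
      case True
      then have "g + mterm c e \<in> supported A" by (simp add: gh supported_add mterm_supported)
      moreover have "f + mterm c e = g + mterm c e + h" by (simp add: gh)
      ultimately show ?thesis using gh(2) by blast
    next
      case False
      then have "h + mterm c e \<in> supported A'" using add.hyps by (simp add: gh supported_add mterm_supported)
      moreover have "f + mterm c e = g + (h + mterm c e)" by (simp add: gh)
      ultimately show ?thesis using gh(1) by blast
    qed
  qed
  then show thesis using that by blast
qed

section \<open>Primes defined by a face of an exponent monoid\<close>

lemma domain_ring_of_type_algebra: "domain (ring_of_type_algebra :: 'a::idom ring)"
proof -
  interpret cring "ring_of_type_algebra :: 'a ring" ..
  show ?thesis by unfold_locales (auto simp: ring_of_type_algebra_def)
qed

text \<open>For \<open>H\<close> containing 0 and closed under addition this is the monoid algebra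
  K[H], realized inside S[t].\<close>

abbreviation supported_ring :: "expo set \<Rightarrow> 'k::field mpoly poly ring" where
  "supported_ring H \<equiv> ring_of_type_algebra\<lparr>carrier := supported H\<rparr>"

lemma ring_of_type_algebra_simps [simp]:
  "f \<otimes>\<^bsub>ring_of_type_algebra\<^esub> g = f * g"
  "f \<oplus>\<^bsub>ring_of_type_algebra\<^esub> g = f + g"
  "\<one>\<^bsub>ring_of_type_algebra\<^esub> = 1"
  "\<zero>\<^bsub>ring_of_type_algebra\<^esub> = 0"
  by (simp_all add: ring_of_type_algebra_def)

locale exponent_monoid =
  fixes H :: "expo set"
  assumes zero_mem: "0 \<in> H"
    and add_mem: "g \<in> H \<Longrightarrow> h \<in> H \<Longrightarrow> g + h \<in> H"
begin

lemma supported_times: "f \<in> supported H \<Longrightarrow> g \<in> supported H \<Longrightarrow> f * g \<in> supported H"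
  by (rule supported_mult) (auto intro: add_mem)

lemma one_supported: "1 \<in> supported H"
  using mterm_supported[OF zero_mem, of 1] by (simp add: mterm_1_0)

lemma subring_supported: "subring (supported H) (ring_of_type_algebra :: 'k::field mpoly poly ring)"
proof -
  interpret domain "ring_of_type_algebra :: 'k mpoly poly ring"
    by (rule domain_ring_of_type_algebra)
  have m: "\<ominus>\<^bsub>ring_of_type_algebra\<^esub> f = - f" for f :: "'k mpoly poly"
    by (rule minus_equality) (auto simp: ring_of_type_algebra_def)
  show ?thesis
  proof (rule subringI)
    fix f :: "'k mpoly poly" assume "f \<in> supported H"
    then show "\<ominus>\<^bsub>ring_of_type_algebra\<^esub> f \<in> supported H" unfolding m by (rule supported_uminus)
  qed (auto simp: ring_of_type_algebra_def one_supported supported_times supported_add)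
qed

lemma domain_supported: "domain (supported_ring H :: 'k::field mpoly poly ring)"
  by (rule domain.subring_is_domain[OF domain_ring_of_type_algebra subring_supported])

text \<open>\<open>A\<close> is an ideal of the monoid \<open>H\<close>, and multiplying terms adds
  exponents.\<close>

lemma ideal_supported:
  assumes "A \<subseteq> H" and AH: "\<And>a h. a \<in> A \<Longrightarrow> h \<in> H \<Longrightarrow> a + h \<in> A"
  shows "ideal (supported A) (supported_ring H :: 'k::field mpoly poly ring)"
proof -
  interpret domain "supported_ring H :: 'k mpoly poly ring" by (rule domain_supported)
  have AH': "supported A \<subseteq> supported H" by (rule supported_mono) fact
  have m: "inv\<^bsub>add_monoid (supported_ring H)\<^esub> f = - f" if "f \<in> supported A" for f :: "'k mpoly poly"
    unfolding a_inv_def[symmetric]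
    by (rule minus_equality) (use that AH' in \<open>auto intro: supported_uminus\<close>)
  have t: "f * g \<in> supported A" if "f \<in> supported A" "g \<in> supported H" for f g :: "'k mpoly poly"
    using that by (rule supported_mult) (rule AH)
  show ?thesis
  proof (rule idealI)
    show "subgroup (supported A) (add_monoid (supported_ring H :: 'k mpoly poly ring))"
    proof (rule subgroup.intro)
      fix f :: "'k mpoly poly" assume "f \<in> supported A"
      then show "inv\<^bsub>add_monoid (supported_ring H)\<^esub> f \<in> supported A"
        by (simp only: m supported_uminus)
    qed (use AH' in \<open>auto intro: supported_add\<close>)
  qed (use t in \<open>auto simp: mult.commute intro: ring_axioms\<close>)
qed

lemma supported_subset_ideal:
  assumes I: "ideal I (supported_ring H :: 'k::field mpoly poly ring)"
    and A: "\<And>a. a \<in> A \<Longrightarrow> mterm 1 a \<in> I"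
  shows "supported A \<subseteq> I"
proof
  interpret ideal I "supported_ring H :: 'k mpoly poly ring" by (rule I)
  fix f :: "'k mpoly poly" assume "f \<in> supported A"
  then show "f \<in> I"
  proof (induction rule: supported_induct)
    case zero
    then show ?case using additive_subgroup.zero_closed[OF is_additive_subgroup] by simp
  next
    case (add f c h)
    \<comment> \<open>Scalars are the terms of exponent 0, which lie in the ring, so only monomials
      with coefficient 1 have to be tested.\<close>
    have "mterm c 0 * mterm 1 h \<in> I"
      using I_l_closed[of "mterm 1 h" "mterm c 0"] A[OF add.hyps(2)] by (simp add: mterm_supported zero_mem)
    then show ?case using additive_subgroup.a_closed[OF is_additive_subgroup add.IH, of "mterm c h"] by (simp add: mterm_mult)
  qed
qed

text \<open>A homogeneous linear inequality valid on \<open>H\<close>; its zero set in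
  \<open>H\<close> is a face of the monoid.\<close>

definition nonneg_form :: "(expo \<Rightarrow> int) \<Rightarrow> bool" where
  "nonneg_form l \<longleftrightarrow> (\<forall>g h. l (g + h) = l g + l h) \<and> (\<forall>h\<in>H. 0 \<le> l h)"

text \<open>Monomials outside a prime are closed under multiplication. Multiplying one witness per
  form makes every form positive, the other factors contributing nonnegative values; the
  \<open>N\<close>-th power then reaches the bound.\<close>

lemma prime_avoiding_monomial:
  assumes P: "primeideal P (supported_ring H :: 'k::field mpoly poly ring)"
    and fin: "finite \<Lambda>" and form: "\<And>l. l \<in> \<Lambda> \<Longrightarrow> nonneg_form l"
    and ex: "\<And>l. l \<in> \<Lambda> \<Longrightarrow> \<not> supported {h \<in> H. 0 < l h} \<subseteq> P"
  obtains h where "h \<in> H" "mterm 1 h \<notin> P" "\<And>l. l \<in> \<Lambda> \<Longrightarrow> int N \<le> l h"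
proof -
  interpret primeideal P "supported_ring H :: 'k mpoly poly ring" by (rule P)
  have times: "mterm 1 (g + h) \<notin> P" if "g \<in> H" "h \<in> H" "mterm 1 g \<notin> P" "mterm 1 h \<notin> P" for g h
  proof
    assume "mterm 1 (g + h) \<in> P"
    then have "(mterm 1 g :: 'k mpoly poly) * mterm 1 h \<in> P" by (simp add: mterm_mult)
    then show False
      using I_prime[of "mterm 1 g" "mterm 1 h"] that by (simp add: mterm_supported)
  qed
  have one: "mterm 1 0 \<notin> P"
    using one_imp_carrier I_notcarr by (auto simp: mterm_1_0)
  have "\<exists>h\<in>H. mterm 1 h \<notin> P \<and> (\<forall>l\<in>\<Lambda>. 0 < l h)"
    using fin form ex
  proof (induction \<Lambda> rule: finite_induct)
    case empty
    then show ?case using zero_mem one by auto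
  next
    case (insert l \<Lambda>)
    obtain g where g: "g \<in> H" "mterm 1 g \<notin> P" "\<forall>l\<in>\<Lambda>. 0 < l g"
      using insert.IH insert.prems by auto
    have "\<not> supported {h \<in> H. 0 < l h} \<subseteq> P" by (rule insert.prems) simp
    \<comment> \<open>If every monomial with \<open>0 < l h\<close> were in \<open>P\<close>, their
      span would be too, by \<open>supported_subset_ideal\<close>.\<close>
    then obtain h where h: "h \<in> H" "0 < l h" "mterm 1 h \<notin> P"
      using supported_subset_ideal[OF is_ideal, of "{h \<in> H. 0 < l h}"] by blast
    have "0 < l' (g + h)" if "l' \<in> insert l \<Lambda>" for l'
      using g h insert.prems(1)[OF that] that unfolding nonneg_form_def
      by (metis add_nonneg_pos add_pos_nonneg insertE)
    then show ?case using times[OF g(1) h(1)] g h add_mem by blast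
  qed
  then obtain h where h: "h \<in> H" "mterm 1 h \<notin> P" "\<forall>l\<in>\<Lambda>. 0 < l h" by blast
  have "\<exists>h\<in>H. mterm 1 h \<notin> P \<and> (\<forall>l\<in>\<Lambda>. int N \<le> l h)"
  proof (induction N)
    case 0
    then show ?case using h by (auto intro: less_imp_le)
  next
    case (Suc N)
    then obtain g where g: "g \<in> H" "mterm 1 g \<notin> P" "\<forall>l\<in>\<Lambda>. int N \<le> l g" by blast
    have "int (Suc N) \<le> l (g + h)" if "l \<in> \<Lambda>" for l
    proof -
      have "l (g + h) = l g + l h" "0 < l h" "int N \<le> l g"
        using form[OF that] g(3) h(3) that unfolding nonneg_form_def by blast+
      then show ?thesis by simp
    qed
    then show ?case using times[OF g(1) h(1) g(2) h(2)] add_mem[OF g(1) h(1)] by blast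
  qed
  then show thesis using that by blast
qed

end

text \<open>The locale captures regularity in codimension one at the face \<open>l = 0\<close>: up to the unit \<open>w\<close>
  of the localization, \<open>u\<close> divides every monomial of the face's prime, so \<open>u\<close> is a uniformizer.\<close>

locale facet_form = exponent_monoid +
  fixes l :: "expo \<Rightarrow> int" and u w :: expo
  assumes form: "nonneg_form l"
    and u: "u \<in> H" "l u = 1" and w: "w \<in> H" "l w = 0"
    and exchange: "\<And>h. h \<in> H \<Longrightarrow> 0 < l h \<Longrightarrow> \<exists>h'\<in>H. h + w = u + h'"
begin

lemma l_add [simp]: "l (g + h) = l g + l h"
  using form unfolding nonneg_form_def by blast

lemma l_nonneg: "h \<in> H \<Longrightarrow> 0 \<le> l h"
  using form by (simp add: nonneg_form_def)

lemma l_0 [simp]: "l 0 = 0"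
  using l_add[of 0 0] by simp

definition facet_ideal :: "'k::field mpoly poly set" where
  "facet_ideal = supported {h \<in> H. 0 < l h}"

text \<open>Modulo this ideal only the exponents on the face \<open>l = 0\<close> survive, and their
  span is a subring of the domain S[t]. Concretely, the face parts of two factors multiply to the
  face part of the product.\<close>

lemma primeideal_facet_ideal:
  "primeideal facet_ideal (supported_ring H :: 'k::field mpoly poly ring)"
proof (rule primeidealI)
  interpret domain "supported_ring H :: 'k mpoly poly ring" by (rule domain_supported)
  show "cring (supported_ring H :: 'k mpoly poly ring)" by (rule is_cring)
  show "ideal facet_ideal (supported_ring H :: 'k mpoly poly ring)"
    unfolding facet_ideal_def
    by (rule ideal_supported) (auto intro: add_mem simp: add_pos_nonneg l_nonneg)
  have "(1 :: 'k mpoly poly) \<notin> facet_ideal"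
    using mterm_supported_iff[of "1 :: 'k" 0 "{h \<in> H. 0 < l h}"] by (simp add: facet_ideal_def mterm_1_0)
  then show "carrier (supported_ring H) \<noteq> (facet_ideal :: 'k mpoly poly set)"
    using one_supported by auto
next
  let ?A = "{h \<in> H. l h = 0}" and ?A' = "{h \<in> H. 0 < l h}"
  have HA: "H = ?A \<union> ?A'" using l_nonneg by force
  fix f g :: "'k mpoly poly"
  assume "f \<in> carrier (supported_ring H)" "g \<in> carrier (supported_ring H)"
    and "f \<otimes>\<^bsub>supported_ring H\<^esub> g \<in> facet_ideal"
  then have f: "f \<in> supported (?A \<union> ?A')" and g: "g \<in> supported (?A \<union> ?A')"
    and fg: "f * g \<in> supported ?A'"
    using HA by (auto simp: facet_ideal_def)
  obtain f0 f1 where f0: "f0 \<in> supported ?A" and f1: "f1 \<in> supported ?A'" and f_eq: "f = f0 + f1"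
    using supported_split[OF f] .
  obtain g0 g1 where g0: "g0 \<in> supported ?A" and g1: "g1 \<in> supported ?A'" and g_eq: "g = g0 + g1"
    using supported_split[OF g] .
  have "f0 * g1 \<in> supported ?A'"
    using f0 g1 by (rule supported_mult) (auto intro: add_mem)
  moreover have "f1 * g \<in> supported ?A'"
    using f1 g by (rule supported_mult) (auto intro: add_mem)
  moreover have "f0 * g0 = f * g - (f0 * g1 + f1 * g)"
    by (simp add: f_eq g_eq algebra_simps)
  ultimately have "f0 * g0 \<in> supported ?A'"
    using fg by (simp add: supported_add supported_diff)
  moreover have "f0 * g0 \<in> supported ?A"
    using f0 g0 by (rule supported_mult) (auto intro: add_mem)
  \<comment> \<open>The product is supported both on \<open>l = 0\<close> and on
    \<open>l > 0\<close>; absence of zero divisors in S[t] then kills one face part.\<close>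
  ultimately have "f0 * g0 = 0"
    by (rule supported_disjoint) auto
  then have "f0 = 0 \<or> g0 = 0" by simp
  then show "f \<in> facet_ideal \<or> g \<in> facet_ideal"
    using f1 g1 by (auto simp: f_eq g_eq facet_ideal_def)
qed

lemma facet_ideal_nonzero: "(facet_ideal :: 'k::field mpoly poly set) \<noteq> {0}"
proof -
  have "(mterm 1 u :: 'k mpoly poly) \<in> facet_ideal"
    unfolding facet_ideal_def by (rule mterm_supported) (simp add: u)
  moreover have "(mterm 1 u :: 'k mpoly poly) \<noteq> 0" by simp
  ultimately show ?thesis by blast
qed

text \<open>Linear extension of \<open>exchange\<close>: once \<open>w\<close> is inverted,
  \<open>u\<close> generates the ideal.\<close>

lemma facet_ideal_exchange:
  assumes "f \<in> facet_ideal"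
  shows "\<exists>g\<in>supported H. mterm 1 w * f = mterm 1 u * g"
  using assms unfolding facet_ideal_def
proof (induction rule: supported_induct)
  case zero
  show ?case by (rule bexI[of _ 0]) auto
next
  case (add f c h)
  then obtain g where g: "g \<in> supported H" "mterm 1 w * f = mterm 1 u * g" by blast
  obtain h' where h': "h' \<in> H" "h + w = u + h'" using exchange add.hyps by blast
  have "mterm 1 w * mterm c h = mterm 1 u * mterm c h'"
    using h'(2) by (simp add: mterm_mult add.commute)
  then have "mterm 1 w * (f + mterm c h) = mterm 1 u * (g + mterm c h')"
    by (simp add: g(2) distrib_left)
  then show ?case using g(1) h'(1) by (blast intro: supported_add mterm_supported)
qed

text \<open>If \<open>u\<close> is in \<open>Q\<close>, exchange puts every
  \<open>mterm 1 w * f\<close> in \<open>Q\<close>, and \<open>w\<close> can be cancelled because it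
  is outside the prime. If \<open>u\<close> is not in \<open>Q\<close>, elements of \<open>Q\<close>
  can be divided by \<open>u\<close> forever, so only 0 could be in \<open>Q\<close>.\<close>

lemma facet_ideal_minimal:
  assumes Q: "primeideal Q (supported_ring H :: 'k::field mpoly poly ring)"
    and sub: "Q \<subseteq> facet_ideal" and nz: "Q \<noteq> {0}"
  shows "Q = facet_ideal"
proof (cases "mterm 1 u \<in> Q")
  case True
  interpret primeideal Q "supported_ring H :: 'k mpoly poly ring" by (rule Q)
  have wQ: "(mterm 1 w :: 'k mpoly poly) \<notin> facet_ideal"
    by (simp add: facet_ideal_def mterm_supported_iff w)
  have "f \<in> Q" if f: "f \<in> facet_ideal" for f
  proof -
    obtain g where "g \<in> supported H" "mterm 1 w * f = mterm 1 u * g"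
      using facet_ideal_exchange[OF f] by blast
    then have "mterm 1 w * f \<in> Q" using I_r_closed[OF True, of g] by simp
    moreover have "f \<in> supported H"
      using f supported_mono[of "{h \<in> H. 0 < l h}" H] by (auto simp: facet_ideal_def)
    ultimately show ?thesis
      using I_prime[of "mterm 1 w" f] wQ sub w by (auto simp: mterm_supported)
  qed
  then show ?thesis using sub by blast
next
  case False
  interpret primeideal Q "supported_ring H :: 'k mpoly poly ring" by (rule Q)
  \<comment> \<open>Dividing \<open>mterm 1 w * f\<close> by \<open>u \<notin> Q\<close> stays in \<open>Q\<close> but lowers \<open>l\<close> by one, so \<open>l\<close> is unboundedly
    large on the support of every element of \<open>Q\<close>.\<close>
  have deep: "Q \<subseteq> supported {h \<in> H. int r \<le> l h}" for r
  proof (induction r)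
    case 0
    have "{h \<in> H. 0 < l h} \<subseteq> {h \<in> H. int 0 \<le> l h}" by auto
    from supported_mono[OF this] show ?case using sub unfolding facet_ideal_def by blast
  next
    case (Suc r)
    let ?A = "{h \<in> H. l h < int (Suc r)}" and ?A' = "{h \<in> H. int (Suc r) \<le> l h}"
    show ?case
    proof
      fix f assume f: "f \<in> Q"
      then have fH: "f \<in> supported H" using a_subset by auto
      obtain g where g: "g \<in> supported H" "mterm 1 w * f = mterm 1 u * g"
        using facet_ideal_exchange f sub by blast
      have "mterm 1 w * f \<in> Q"
        using I_l_closed[OF f, of "mterm 1 w"] w by (simp add: mterm_supported)
      then have "g \<in> Q"
        using I_prime[of "mterm 1 u" g] False g u by (auto simp: mterm_supported)
      then have gs: "g \<in> supported {h \<in> H. int r \<le> l h}" using Suc by blast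
      have "mterm 1 u \<in> supported {u}" by (simp add: mterm_supported)
      then have wf: "mterm 1 w * f \<in> supported ?A'"
        unfolding g(2) using gs by (rule supported_mult) (use u in \<open>auto intro: add_mem\<close>)
      have "H = ?A \<union> ?A'" by auto
      with fH have "f \<in> supported (?A \<union> ?A')" by simp
      then obtain f0 f1 where f0: "f0 \<in> supported ?A" and f1: "f1 \<in> supported ?A'" and f_eq: "f = f0 + f1"
        by (rule supported_split)
      have ws: "mterm 1 w \<in> supported {w}" by (simp add: mterm_supported)
      have "mterm 1 w * f1 \<in> supported ?A'"
        using ws f1 by (rule supported_mult) (use w in \<open>auto intro: add_mem\<close>)
      \<comment> \<open>As \<open>l w = 0\<close>, multiplication by \<open>w\<close> preserves
        levels: the left side sits below level \<open>Suc r\<close>, the right side at or above it,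
        so \<open>f0\<close> vanishes.\<close>
      moreover have "mterm 1 w * f0 = mterm 1 w * f - mterm 1 w * f1"
        by (simp add: f_eq algebra_simps)
      ultimately have "mterm 1 w * f0 \<in> supported ?A'" using wf by (simp add: supported_diff)
      moreover have "mterm 1 w * f0 \<in> supported ?A"
        using ws f0 by (rule supported_mult) (use w in \<open>auto intro: add_mem\<close>)
      ultimately have "mterm 1 w * f0 = 0" by (rule supported_disjoint) auto
      then show "f \<in> supported ?A'" using f1 by (simp add: f_eq)
    qed
  qed
  have "0 \<in> Q" using additive_subgroup.zero_closed[OF is_additive_subgroup] by simp
  then obtain f where f: "f \<in> Q" "f \<noteq> 0" using nz by blast
  then obtain h where h: "h \<in> exponents f" using exponents_eq_empty_iff by blast
  \<comment> \<open>The level is chosen one above the value of \<open>l\<close> at an exponent that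
    actually occurs in \<open>f\<close>.\<close>
  have "f \<in> supported {h' \<in> H. int (Suc (nat (l h))) \<le> l h'}" using deep f by blast
  then have "int (Suc (nat (l h))) \<le> l h" using h unfolding supported_def by blast
  then show ?thesis by (simp split: if_splits)
qed

end

section \<open>Prime ideals of height one over a least prime\<close>

text \<open>In a chain of length at least two, the member just below \<open>P\<close> must be
  \<open>Z\<close> by minimality, yet it strictly contains a prime, which in turn contains
  \<open>Z\<close>.\<close>

lemma height_eq_1I:
  assumes Z: "primeideal Z R" and P: "primeideal P R" and ZP: "Z \<subset> P"
    and least: "\<And>Q. primeideal Q R \<Longrightarrow> Z \<subseteq> Q"
    and minimal: "\<And>Q. primeideal Q R \<Longrightarrow> Q \<subseteq> P \<Longrightarrow> Q \<noteq> Z \<Longrightarrow> Q = P"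
  shows "height R P = 1"
proof -
  have "enat l \<le> 1" if Q: "\<forall>i\<le>l. primeideal (Q i) R" "\<forall>i<l. Q i \<subset> Q (Suc i)" "Q l = P"
    for l and Q :: "nat \<Rightarrow> 'a set"
  proof (rule ccontr)
    assume "\<not> enat l \<le> 1"
    then obtain k where l: "l = Suc (Suc k)"
      by (metis One_nat_def enat_ord_simps(1) not0_implies_Suc not_less_eq_eq one_enat_def zero_le)
    then have "Q k \<subset> Q (Suc k)" "Q (Suc k) \<subset> P" "primeideal (Q k) R" "primeideal (Q (Suc k)) R"
      using Q by (auto simp: le_Suc_eq)
    then show False using minimal[of "Q (Suc k)"] least[of "Q k"] by blast
  qed
  moreover have "\<exists>Q. (\<forall>i\<le>1. primeideal (Q i) R) \<and> (\<forall>i<1. Q i \<subset> Q (Suc i)) \<and> Q 1 = P"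
    by (rule exI[of _ "\<lambda>i::nat. if i = 0 then Z else P"]) (use Z P ZP in auto)
  ultimately show ?thesis
    unfolding height_def by (intro antisym Sup_least Sup_upper) (auto simp: one_enat_def)
qed

text \<open>Otherwise \<open>Z\<close>, \<open>Q\<close>, \<open>P\<close> would be a chain of
  length two.\<close>

lemma height_eq_1D:
  assumes "height R P = 1" "primeideal P R" "primeideal Z R" "primeideal Q R" "Z \<subset> Q" "Q \<subseteq> P"
  shows "Q = P"
proof (rule ccontr)
  assume "Q \<noteq> P"
  define C where "C = (\<lambda>i::nat. if i = 0 then Z else if i = 1 then Q else P)"
  have "(\<forall>i\<le>2. primeideal (C i) R) \<and> (\<forall>i<2. C i \<subset> C (Suc i)) \<and> C 2 = P"
    using assms \<open>Q \<noteq> P\<close> by (auto simp: C_def less_2_cases_iff)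
  then have "enat 2 \<le> height R P"
    unfolding height_def by (intro Sup_upper) blast
  then show False using assms(1) by (simp add: one_enat_def)
qed

section \<open>The toric ring of a partition\<close>

definition face_expo :: "nat set \<Rightarrow> expo" where
  "face_expo F = (\<Sum>i\<in>F. Poly_Mapping.single i 1, 1)"

lemma snd_face_expo [simp]: "snd (face_expo F) = 1"
  by (simp add: face_expo_def)

lemma lookup_face_expo:
  assumes "finite F"
  shows "Poly_Mapping.lookup (fst (face_expo F)) i = (if i \<in> F then 1 else 0)"
  using assms by (simp add: face_expo_def lookup_sum lookup_single when_def)

lemma xFt_eq_mterm:
  assumes "finite F"
  shows "(xFt F :: 'k::field mpoly poly) = mterm 1 (face_expo F)"
proof -
  have "(\<Prod>i\<in>F. mvar i :: 'k mpoly) = Poly_Mapping.single (\<Sum>i\<in>F. Poly_Mapping.single i 1) 1"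
    using assms by (induction F rule: finite_induct) (simp_all add: mvar_def mult_single)
  then show ?thesis by (simp add: xFt_def mterm_def face_expo_def)
qed

lemma xFt_in_monomials:
  assumes "F \<subseteq> {1..n}"
  shows "(xFt F :: 'k::field mpoly poly) \<in> monomials n"
proof -
  define a where "a = (\<lambda>i. if i \<in> F then 1 else (0::nat))"
  have "(\<Prod>i\<in>F. mvar i :: 'k mpoly) = (\<Prod>i\<in>{1..n}. mvar i ^ a i)"
    using assms by (intro prod.mono_neutral_cong_left) (auto simp: a_def)
  then show ?thesis
    unfolding monomials_def xFt_def by (intro CollectI exI[of _ a] exI[of _ 1]) simp
qed

text \<open>The blocks stand for the maximal cliques. The bound \<open>3 \<le> d\<close> is the
  hypothesis on the dimension; the resulting room \<open>2 \<le> d - 1\<close> is what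
  \<open>facet_form_vertex\<close> uses.\<close>

locale partition_toric =
  fixes n d :: nat and \<B> :: "nat set set"
  assumes part: "partition_on {1..n} \<B>" and n: "1 \<le> n" and d: "3 \<le> d"
    and block_card: "C \<in> \<B> \<Longrightarrow> d \<le> card C"
begin

text \<open>The join of the (d-2)-dimensional skeleta of the simplices on the blocks;
  \<open>Ind_eq\<close> identifies it with the independence complex.\<close>

definition \<Gamma> :: "nat set set" where
  "\<Gamma> = {A. A \<subseteq> {1..n} \<and> (\<forall>C\<in>\<B>. card (A \<inter> C) < d)}"

text \<open>Inequality description of the monoid generated by the exponents of the faces; in degree
  0 it leaves only the exponent 0.\<close>

definition H :: "expo set" where
  "H = {h. Poly_Mapping.keys (fst h) \<subseteq> {1..n} \<and> (\<forall>i. Poly_Mapping.lookup (fst h) i \<le> snd h) \<and>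
     (\<forall>C\<in>\<B>. (\<Sum>i\<in>C. Poly_Mapping.lookup (fst h) i) \<le> (d - 1) * snd h)}"

lemma block_subset: "C \<in> \<B> \<Longrightarrow> C \<subseteq> {1..n}"
  using part by (auto simp: partition_on_def)

lemma block_finite: "C \<in> \<B> \<Longrightarrow> finite C"
  using block_subset finite_subset by blast

lemma block_disjoint: "C \<in> \<B> \<Longrightarrow> C' \<in> \<B> \<Longrightarrow> C \<noteq> C' \<Longrightarrow> C \<inter> C' = {}"
  using part by (auto simp: partition_on_def disjoint_def)

lemma block_cover: "i \<in> {1..n} \<Longrightarrow> \<exists>C\<in>\<B>. i \<in> C"
  using part by (auto simp: partition_on_def)

lemma finite_blocks: "finite \<B>"
  by (rule finite_elements[OF _ part]) simp

lemma face_finite: "F \<in> \<Gamma> \<Longrightarrow> finite F"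
  unfolding \<Gamma>_def using finite_subset by blast

lemma sum_face_expo:
  assumes "finite F" "finite C"
  shows "(\<Sum>i\<in>C. Poly_Mapping.lookup (fst (face_expo F)) i) = card (F \<inter> C)"
  using assms by (simp add: lookup_face_expo sum.If_cases Int_commute Collect_mem_eq)

lemma keys_face_expo: "finite F \<Longrightarrow> Poly_Mapping.keys (fst (face_expo F)) = F"
  by (auto simp: in_keys_iff lookup_face_expo split: if_splits)

lemma face_expo_in_H:
  assumes "F \<in> \<Gamma>"
  shows "face_expo F \<in> H"
proof -
  have "card (F \<inter> C) \<le> d - 1" if "C \<in> \<B>" for C
    using assms that by (fastforce simp: \<Gamma>_def)
  then have "(\<Sum>i\<in>C. Poly_Mapping.lookup (fst (face_expo F)) i) \<le> (d - 1) * snd (face_expo F)"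
    if "C \<in> \<B>" for C
    using that by (simp only: sum_face_expo face_finite[OF assms] block_finite snd_face_expo mult_1_right)
  moreover have "Poly_Mapping.keys (fst (face_expo F)) \<subseteq> {1..n}"
    using assms by (simp add: keys_face_expo face_finite) (simp add: \<Gamma>_def)
  moreover have "Poly_Mapping.lookup (fst (face_expo F)) i \<le> snd (face_expo F)" for i
    by (simp add: lookup_face_expo face_finite[OF assms])
  ultimately show ?thesis unfolding H_def by blast
qed

lemma empty_face: "{} \<in> \<Gamma>"
  using d by (simp add: \<Gamma>_def)

sublocale exponent_monoid H
proof
  show "0 \<in> H" by (simp add: H_def)
next
  fix g h assume "g \<in> H" "h \<in> H"
  then show "g + h \<in> H"
    using keys_add[of "fst g" "fst h"]
    by (auto simp: H_def lookup_add sum.distrib distrib_left intro: add_mono)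
qed

text \<open>Normality of the toric ring: split off a face inside the support that contains every
  coordinate equal to the degree and is as large as possible in each block.\<close>

lemma H_decompose:
  assumes h: "h \<in> H" and pos: "0 < snd h"
  shows "\<exists>F\<in>\<Gamma>. \<exists>h'\<in>H. h = face_expo F + h'"
proof -
  define a where "a = Poly_Mapping.lookup (fst h)"
  define k where "k = snd h - 1"
  have k: "snd h = Suc k" using pos by (simp add: k_def)
  have a: "a i \<le> Suc k" "a i \<noteq> 0 \<Longrightarrow> i \<in> {1..n}" for i
  proof -
    have "Poly_Mapping.keys (fst h) \<subseteq> {1..n}" "\<forall>i. a i \<le> Suc k"
      using h by (simp_all add: H_def a_def k)
    then show "a i \<le> Suc k" "a i \<noteq> 0 \<Longrightarrow> i \<in> {1..n}"
      using in_keys_iff[of i "fst h"] unfolding a_def by blast+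
  qed
  have a_sum: "(\<Sum>i\<in>C. a i) \<le> (d - 1) * Suc k" if "C \<in> \<B>" for C
    using h that by (auto simp: H_def a_def k)
  \<comment> \<open>The face to be split off must lie in the support \<open>S\<close>, and must
    contain \<open>T\<close>, since the remainder has degree only \<open>k\<close>.\<close>
  define S where "S = {i. a i \<noteq> 0}"
  define T where "T = {i. a i = Suc k}"
  have "\<forall>C\<in>\<B>. \<exists>Y. T \<inter> C \<subseteq> Y \<and> Y \<subseteq> S \<inter> C \<and> card Y \<le> d - 1 \<and> (card Y = d - 1 \<or> Y = S \<inter> C)"
  proof
    fix C assume C: "C \<in> \<B>"
    show "\<exists>Y. T \<inter> C \<subseteq> Y \<and> Y \<subseteq> S \<inter> C \<and> card Y \<le> d - 1 \<and> (card Y = d - 1 \<or> Y = S \<inter> C)"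
    proof (cases "card (S \<inter> C) \<le> d - 1")
      case True
      then show ?thesis by (intro exI[of _ "S \<inter> C"]) (auto simp: S_def T_def)
    next
      case False
      \<comment> \<open>Each coordinate in \<open>T\<close> contributes \<open>Suc k\<close> to the
        block sum, so the block inequality allows at most \<open>d - 1\<close> of them.\<close>
      have "card (T \<inter> C) * Suc k = (\<Sum>i\<in>T \<inter> C. a i)" by (simp add: T_def)
      also have "\<dots> \<le> (\<Sum>i\<in>C. a i)"
        using block_finite[OF C] by (intro sum_mono2) auto
      also have "\<dots> \<le> (d - 1) * Suc k" by (rule a_sum[OF C])
      finally have "card (T \<inter> C) \<le> d - 1" by (simp only: mult_le_cancel2)
      moreover have "T \<inter> C \<subseteq> S \<inter> C" by (auto simp: S_def T_def)
      ultimately obtain Y where "T \<inter> C \<subseteq> Y" "Y \<subseteq> S \<inter> C" "card Y = d - 1"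
        using exists_subset_between[of "T \<inter> C" "d - 1" "S \<inter> C"] False block_finite[OF C] by auto
      then show ?thesis by auto
    qed
  qed
  from bchoice[OF this] obtain Y where Y': "\<forall>C\<in>\<B>. T \<inter> C \<subseteq> Y C \<and> Y C \<subseteq> S \<inter> C \<and>
      card (Y C) \<le> d - 1 \<and> (card (Y C) = d - 1 \<or> Y C = S \<inter> C)" by (rule exE)
  have Y: "T \<inter> C \<subseteq> Y C" "Y C \<subseteq> S \<inter> C" "card (Y C) \<le> d - 1" "card (Y C) = d - 1 \<or> Y C = S \<inter> C"
    if "C \<in> \<B>" for C
    using bspec[OF Y' that] by simp_all
  define F where "F = (\<Union>C\<in>\<B>. Y C)"
  have FC: "F \<inter> C = Y C" if C: "C \<in> \<B>" for C
  proof -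
    have "Y C' \<inter> C = {}" if "C' \<in> \<B>" "C' \<noteq> C" for C'
      using Y(2)[OF that(1)] block_disjoint[OF that(1) C that(2)] by blast
    then show ?thesis using Y(2)[OF C] C unfolding F_def by blast
  qed
  have F_sub: "F \<subseteq> {1..n}"
    using Y(2) block_subset unfolding F_def by blast
  have F: "F \<in> \<Gamma>"
    unfolding \<Gamma>_def using F_sub FC Y(3) d by (auto simp: less_eq_Suc_le le_diff_conv2 intro: le_less_trans)
  have F_fin: "finite F" using F by (rule face_finite)
  have FS: "a i \<noteq> 0" if "i \<in> F" for i
    using that Y(2) by (auto simp: F_def S_def)
  have TF: "i \<in> F" if i: "a i = Suc k" for i
  proof -
    have "i \<in> {1..n}" using a(2)[of i] i by simp
    then obtain C where "C \<in> \<B>" "i \<in> C" using block_cover by blast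
    then show ?thesis using Y(1) i by (auto simp: F_def T_def)
  qed
  \<comment> \<open>The subtraction is truncated, but exact here because \<open>F\<close> lies in
    the support (\<open>FS\<close>).\<close>
  define b where "b = fst h - fst (face_expo F)"
  have b: "Poly_Mapping.lookup b i = (if i \<in> F then a i - 1 else a i)" for i
    by (simp add: b_def lookup_minus a_def lookup_face_expo F_fin)
  have eq: "h = face_expo F + (b, k)"
  proof (rule prod_eqI)
    show "fst h = fst (face_expo F + (b, k))"
      by (rule poly_mapping_eqI) (use FS in \<open>auto simp: lookup_add b lookup_face_expo F_fin a_def\<close>)
  qed (simp add: k)
  have "(b, k) \<in> H"
  proof -
    have bk: "Poly_Mapping.lookup b i \<le> k" for i
      using a(1)[of i] TF[of i] by (cases "a i = Suc k") (auto simp: b)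
    have "Poly_Mapping.keys b \<subseteq> {1..n}"
      using a(2) by (auto simp: in_keys_iff b split: if_splits)
    \<comment> \<open>Either the block sum drops by the full \<open>d - 1\<close>, matching the loss
      of one degree, or \<open>b\<close> lives on the at most \<open>d - 1\<close> coordinates of
      \<open>Y C\<close>, each bounded by \<open>k\<close>.\<close>
    moreover have "(\<Sum>i\<in>C. Poly_Mapping.lookup b i) \<le> (d - 1) * k" if C: "C \<in> \<B>" for C
      using Y(4)[OF C]
    proof
      assume "card (Y C) = d - 1"
      moreover have "(\<Sum>i\<in>C. a i) = card (F \<inter> C) + (\<Sum>i\<in>C. Poly_Mapping.lookup b i)"
        unfolding a_def by (subst eq) (simp add: lookup_add sum.distrib sum_face_expo F_fin block_finite C)
      ultimately show ?thesis using a_sum[OF C] FC[OF C] by simp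
    next
      assume "Y C = S \<inter> C"
      have "(\<Sum>i\<in>C. Poly_Mapping.lookup b i) = (\<Sum>i\<in>Y C. Poly_Mapping.lookup b i)"
        by (rule sum.mono_neutral_right)
          (use block_finite[OF C] \<open>Y C = S \<inter> C\<close> in \<open>auto simp: b S_def\<close>)
      also have "\<dots> \<le> card (Y C) * k"
        using sum_bounded_above[of "Y C" "Poly_Mapping.lookup b" k] bk by simp
      also have "\<dots> \<le> (d - 1) * k" using Y(3)[OF C] by simp
      finally show ?thesis .
    qed
    ultimately show ?thesis using bk by (simp add: H_def)
  qed
  with F eq show ?thesis by blast
qed

section \<open>The toric ring as a monoid algebra, and generators of its form ideals\<close>

lemma snd_0_imp_0: "h \<in> H \<Longrightarrow> snd h = 0 \<Longrightarrow> h = 0"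
  by (auto simp: H_def prod_eq_iff intro: poly_mapping_eqI)

text \<open>By induction on the degree in t, \<open>H_decompose\<close> writes each monomial of K[H]
  as a product of generators \<open>xFt F\<close>; scalars settle degree 0.\<close>

lemma toric_ring_eq: "(toric_ring \<Gamma> :: 'k::field mpoly poly ring) = supported_ring H"
proof -
  let ?T = "ring_of_type_algebra :: 'k mpoly poly ring"
  let ?G = "scalars \<union> xFt ` \<Gamma> :: 'k mpoly poly set"
  interpret T: domain ?T by (rule domain_ring_of_type_algebra)
  have G_carrier: "?G \<subseteq> carrier ?T" by (simp add: ring_of_type_algebra_def)
  have scal: "[:Poly_Mapping.single 0 c:] = mterm c 0" for c :: 'k
    by (simp add: mterm_def Polynomial.monom_0)
  have gen: "mterm c h \<in> generate_ring ?T ?G" if "h \<in> H" for c h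
    using that
  proof (induction "snd h" arbitrary: h)
    case 0
    then have "h = 0" using snd_0_imp_0 by simp
    then show ?case
      unfolding scalars_def scal by (auto intro: generate_ring.incl)
  next
    case (Suc k)
    then obtain F h' where F: "F \<in> \<Gamma>" and h': "h' \<in> H" "h = face_expo F + h'"
      using H_decompose[of h] by auto
    have "mterm c h' \<in> generate_ring ?T ?G"
      using Suc.hyps(2) h' by (intro Suc.hyps(1)) auto
    moreover have "xFt F \<in> generate_ring ?T ?G"
      using F by (intro generate_ring.incl) auto
    ultimately have "xFt F \<otimes>\<^bsub>?T\<^esub> mterm c h' \<in> generate_ring ?T ?G"
      by (intro generate_ring.eng_mult)
    then show ?case by (simp add: xFt_eq_mterm[OF face_finite[OF F]] mterm_mult h'(2))
  qed
  have "generate_ring ?T ?G = supported H"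
  proof
    show "generate_ring ?T ?G \<subseteq> supported H"
      by (rule T.generate_ring_min_subring1[OF G_carrier subring_supported])
        (auto simp: scalars_def scal xFt_eq_mterm face_finite intro!: mterm_supported zero_mem face_expo_in_H)
    show "supported H \<subseteq> generate_ring ?T ?G"
    proof
      fix f :: "'k mpoly poly" assume "f \<in> supported H"
      then show "f \<in> generate_ring ?T ?G"
      proof (induction rule: supported_induct)
        case zero
        then show ?case using gen[OF zero_mem, of 0] by simp
      next
        case (add f c h)
        then show ?case using generate_ring.eng_add[of f ?T ?G "mterm c h"] gen by simp
      qed
    qed
  qed
  then show ?thesis by (simp add: toric_ring_def)
qed

lemma xFt_supported: "F \<in> \<Gamma> \<Longrightarrow> xFt F \<in> supported H"
  by (simp add: xFt_eq_mterm face_finite mterm_supported face_expo_in_H)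

text \<open>By additivity, if a form is positive on a sum of faces, it is positive on one of them.
  This turns the span of monomials into the generators appearing in \<open>P_ideal\<close> and
  \<open>L_ideal\<close>.\<close>

lemma supported_eq_genideal:
  assumes l: "nonneg_form l"
  shows "(supported {h \<in> H. 0 < l h} :: 'k::field mpoly poly set) =
    Idl\<^bsub>supported_ring H\<^esub> {xFt F | F. F \<in> \<Gamma> \<and> 0 < l (face_expo F)}"
    (is "?S = genideal ?R ?G")
proof
  interpret R: domain ?R by (rule domain_supported)
  have G: "?G \<subseteq> carrier ?R" using xFt_supported by auto
  have l_add: "l (g + h) = l g + l h" for g h using l unfolding nonneg_form_def by blast
  have l_nonneg: "0 \<le> l h" if "h \<in> H" for h using l that unfolding nonneg_form_def by blast
  have "l 0 = 0" using l_add[of 0 0] by simp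
  have "ideal ?S ?R"
    by (rule ideal_supported) (auto simp: l_add add_mem add_pos_nonneg l_nonneg)
  then show "genideal ?R ?G \<subseteq> ?S"
    by (rule R.genideal_minimal)
      (auto simp: xFt_eq_mterm face_finite intro!: mterm_supported face_expo_in_H)
  have split: "\<exists>F\<in>\<Gamma>. \<exists>h'\<in>H. 0 < l (face_expo F) \<and> h = face_expo F + h'"
    if "h \<in> H" "0 < l h" for h
    using that
  proof (induction "snd h" arbitrary: h)
    case 0
    then show ?case using snd_0_imp_0 \<open>l 0 = 0\<close> by fastforce
  next
    case (Suc k)
    then obtain F h' where F: "F \<in> \<Gamma>" and h': "h' \<in> H" "h = face_expo F + h'"
      using H_decompose[of h] by auto
    show ?case
    proof (cases "0 < l (face_expo F)")
      case False
      \<comment> \<open>The split-off face does not account for positivity, so the search continues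
        in the remainder, and this face is put back afterwards.\<close>
      then have "0 < l h'" using Suc.prems h' l_add by simp
      moreover have "k = snd h'" using Suc.hyps(2) h' by simp
      ultimately obtain F' h'' where "F' \<in> \<Gamma>" "h'' \<in> H" "0 < l (face_expo F')" "h' = face_expo F' + h''"
        using Suc.hyps(1) h'(1) by blast
      then show ?thesis
        using F h' add_mem[OF face_expo_in_H[OF F]]
        by (intro bexI[of _ F'] bexI[of _ "face_expo F + h''"]) (auto simp: ac_simps)
    qed (use F h' in blast)
  qed
  interpret I: ideal "genideal ?R ?G" ?R by (rule R.genideal_ideal[OF G])
  show "?S \<subseteq> genideal ?R ?G"
  proof (rule supported_subset_ideal[OF I.is_ideal])
    fix h assume "h \<in> {h \<in> H. 0 < l h}"
    then obtain F h' where F: "F \<in> \<Gamma>" "0 < l (face_expo F)" and h': "h' \<in> H" "h = face_expo F + h'"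
      using split by blast
    have "xFt F \<in> genideal ?R ?G" using R.genideal_self[OF G] F by blast
    then have "xFt F * mterm 1 h' \<in> genideal ?R ?G"
      using I.I_r_closed[of "xFt F" "mterm 1 h'"] by (simp add: mterm_supported h'(1))
    then show "mterm 1 h \<in> genideal ?R ?G"
      by (simp add: xFt_eq_mterm face_finite F mterm_mult h')
  qed
qed

section \<open>The facet forms and their uniformizers\<close>

definition vertex_form :: "nat \<Rightarrow> expo \<Rightarrow> int" where
  "vertex_form i h = int (snd h) - int (Poly_Mapping.lookup (fst h) i)"

definition block_form :: "nat set \<Rightarrow> expo \<Rightarrow> int" where
  "block_form C h = int ((d - 1) * snd h) - int (\<Sum>i\<in>C. Poly_Mapping.lookup (fst h) i)"

lemma nonneg_vertex_form: "nonneg_form (vertex_form i)"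
  unfolding nonneg_form_def
proof (intro conjI allI ballI)
  show "vertex_form i (g + h) = vertex_form i g + vertex_form i h" for g h
    by (simp add: vertex_form_def lookup_add)
qed (simp add: vertex_form_def H_def)

lemma nonneg_block_form:
  assumes "C \<in> \<B>"
  shows "nonneg_form (block_form C)"
  unfolding nonneg_form_def
proof (intro conjI allI ballI)
  show "block_form C (g + h) = block_form C g + block_form C h" for g h
    by (simp add: block_form_def lookup_add sum.distrib distrib_left)
  fix h assume "h \<in> H"
  then have "(\<Sum>i\<in>C. Poly_Mapping.lookup (fst h) i) \<le> (d - 1) * snd h"
    using assms by (simp add: H_def)
  then show "0 \<le> block_form C h" unfolding block_form_def by linarith
qed

lemma vertex_form_face: "F \<in> \<Gamma> \<Longrightarrow> 0 < vertex_form i (face_expo F) \<longleftrightarrow> i \<notin> F"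
  by (simp add: vertex_form_def lookup_face_expo face_finite)

lemma block_form_face:
  "F \<in> \<Gamma> \<Longrightarrow> C \<in> \<B> \<Longrightarrow> 0 < block_form C (face_expo F) \<longleftrightarrow> card (F \<inter> C) < d - 1"
  unfolding block_form_def by (subst sum_face_expo) (auto simp: face_finite block_finite)

text \<open>Here \<open>u\<close> is t and \<open>w\<close> is the square of x_i t, so
  \<open>h'\<close> is h times x_i^2 t. Positivity of the form leaves room for the exponent of x_i
  to grow by 2 as the degree grows by 1. Multiplying h by x_i alone could break a block inequality;
  the extra t adds \<open>d - 1\<close> to its bound, at least the 2 that are required.\<close>

lemma facet_form_vertex:
  assumes i: "i \<in> {1..n}"
  shows "facet_form H (vertex_form i) (face_expo {}) (Poly_Mapping.single i 2, 2)"
proof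
  have s: "(\<Sum>j\<in>C. Poly_Mapping.lookup (Poly_Mapping.single i (2::nat)) j) \<le> 2" if "C \<in> \<B>" for C
    using block_finite[OF that] by (simp add: lookup_single when_def)
  show "nonneg_form (vertex_form i)" by (rule nonneg_vertex_form)
  show "face_expo {} \<in> H" by (rule face_expo_in_H[OF empty_face])
  show "vertex_form i (face_expo {}) = 1" by (simp add: vertex_form_def lookup_face_expo)
  have "2 \<le> (d - 1) * 2" using d by simp
  then show "(Poly_Mapping.single i 2, 2) \<in> H"
    using i s by (fastforce simp: H_def lookup_single when_def)
  show "vertex_form i (Poly_Mapping.single i 2, 2) = 0" by (simp add: vertex_form_def)
  fix h assume h: "h \<in> H" "0 < vertex_form i h"
  let ?h' = "h + (Poly_Mapping.single i 2, 1)"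
  have "Poly_Mapping.keys (fst ?h') \<subseteq> {1..n}"
    using h i keys_add[of "fst h" "Poly_Mapping.single i 2"] by (auto simp: H_def)
  moreover have "Poly_Mapping.lookup (fst ?h') j \<le> snd ?h'" for j
  proof -
    have "Poly_Mapping.lookup (fst h) j \<le> snd h" using h by (simp add: H_def)
    then show ?thesis
      using h(2) by (auto simp: lookup_add lookup_single when_def vertex_form_def)
  qed
  moreover have "(\<Sum>j\<in>C. Poly_Mapping.lookup (fst ?h') j) \<le> (d - 1) * snd ?h'" if C: "C \<in> \<B>" for C
  proof -
    have "(\<Sum>j\<in>C. Poly_Mapping.lookup (fst h) j) \<le> (d - 1) * snd h" using h C by (simp add: H_def)
    moreover have "2 \<le> d - 1" using d by simp
    ultimately show ?thesis using s[OF C] by (simp add: lookup_add sum.distrib)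
  qed
  ultimately have "?h' \<in> H" by (simp add: H_def)
  moreover have "h + (Poly_Mapping.single i 2, 2) = face_expo {} + ?h'"
    by (simp add: prod_eq_iff face_expo_def)
  ultimately show "\<exists>h'\<in>H. h + (Poly_Mapping.single i 2, 2) = face_expo {} + h'" by blast
qed

text \<open>Take F inside G inside the block with \<open>d - 2\<close> and \<open>d\<close>
  elements. Then \<open>u\<close> is x_F t, \<open>w\<close> is x_F x_G t^2, and \<open>h'\<close>
  is h times x_G t. Although G is not a face, \<open>w\<close> lies in \<open>H\<close> and on the
  face of the form, since (d - 2) + d = 2 (d - 1).\<close>

lemma facet_form_block:
  assumes C: "C \<in> \<B>"
  shows "\<exists>u w. facet_form H (block_form C) u w"
proof -
  obtain G where G: "G \<subseteq> C" "card G = d" "finite G"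
    using obtain_subset_with_card_n[OF block_card[OF C]] by blast
  have "d - 2 \<le> card G" using G by simp
  then obtain F where F: "F \<subseteq> G" "card F = d - 2" "finite F"
    using obtain_subset_with_card_n by blast
  have C': "G \<inter> C' = {}" "F \<inter> C' = {}" if "C' \<in> \<B>" "C' \<noteq> C" for C'
    using block_disjoint[OF that(1) C that(2)] G F by blast+
  have FC: "F \<inter> C = F" and GC: "G \<inter> C = G" using F G by auto
  have Gn: "G \<subseteq> {1..n}" using G block_subset[OF C] by blast
  have "card (F \<inter> C') < d" if "C' \<in> \<B>" for C'
    using F G card_mono[of F "F \<inter> C'"] d by auto
  then have F_face: "F \<in> \<Gamma>" using Gn F(1) by (auto simp: \<Gamma>_def)
  have "facet_form H (block_form C) (face_expo F) (face_expo F + face_expo G)"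
  proof
    show "nonneg_form (block_form C)" by (rule nonneg_block_form[OF C])
    show "face_expo F \<in> H" by (rule face_expo_in_H[OF F_face])
    show "block_form C (face_expo F) = 1"
      unfolding block_form_def using F d
      by (subst sum_face_expo) (auto simp: block_finite C FC)
    have sum: "(\<Sum>j\<in>C. Poly_Mapping.lookup (fst (face_expo F + face_expo G)) j) = (d - 1) * 2"
      using F G d by (simp add: lookup_add sum.distrib sum_face_expo block_finite C FC GC)
    then show "block_form C (face_expo F + face_expo G) = 0" by (simp add: block_form_def)
    have "(\<Sum>j\<in>C'. Poly_Mapping.lookup (fst (face_expo F + face_expo G)) j) \<le> (d - 1) * 2"
      if "C' \<in> \<B>" for C'
    proof (cases "C' = C")
      case False
      then show ?thesis
        using F G C'[OF that] by (simp add: lookup_add sum.distrib sum_face_expo block_finite that)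
    qed (use sum in simp)
    moreover have "Poly_Mapping.keys (fst (face_expo F + face_expo G)) \<subseteq> {1..n}"
      using keys_add[of "fst (face_expo F)" "fst (face_expo G)"] Gn F G
      by (auto simp: keys_face_expo)
    moreover have "Poly_Mapping.lookup (fst (face_expo F + face_expo G)) j \<le> 2" for j
      using F G by (simp add: lookup_add lookup_face_expo)
    moreover have "snd (face_expo F + face_expo G) = 2" by simp
    ultimately show "face_expo F + face_expo G \<in> H" unfolding H_def mem_Collect_eq by metis
    fix h assume h: "h \<in> H" "0 < block_form C h"
    let ?h' = "h + face_expo G"
    have "Poly_Mapping.keys (fst ?h') \<subseteq> {1..n}"
      using h Gn G keys_add[of "fst h" "fst (face_expo G)"] by (auto simp: H_def keys_face_expo)
    moreover have "Poly_Mapping.lookup (fst ?h') j \<le> snd ?h'" for j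
      using h G by (simp add: H_def lookup_add lookup_face_expo le_SucI)
    moreover have "(\<Sum>j\<in>C'. Poly_Mapping.lookup (fst ?h') j) \<le> (d - 1) * snd ?h'" if "C' \<in> \<B>" for C'
    proof -
      have le: "(\<Sum>j\<in>C'. Poly_Mapping.lookup (fst h) j) \<le> (d - 1) * snd h"
        using h that by (simp add: H_def)
      have eq: "(\<Sum>j\<in>C'. Poly_Mapping.lookup (fst ?h') j) =
          (\<Sum>j\<in>C'. Poly_Mapping.lookup (fst h) j) + card (G \<inter> C')"
        using G that by (simp add: lookup_add sum.distrib sum_face_expo block_finite)
      show ?thesis
      proof (cases "C' = C")
        case True
        \<comment> \<open>G adds \<open>d\<close> to the block sum but only \<open>d - 1\<close> to
          its bound; the strict inequality supplies the missing unit.\<close>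
        have "(\<Sum>j\<in>C. Poly_Mapping.lookup (fst h) j) < (d - 1) * snd h"
          using h(2) unfolding block_form_def by linarith
        then show ?thesis unfolding eq using True G d by (simp add: GC)
      next
        case False
        then show ?thesis unfolding eq using C'[OF that] le by simp
      qed
    qed
    ultimately have "?h' \<in> H" by (simp add: H_def)
    moreover have "h + (face_expo F + face_expo G) = face_expo F + ?h'"
      by (simp add: ac_simps)
    ultimately show "\<exists>h'\<in>H. h + (face_expo F + face_expo G) = face_expo F + h'" by blast
  qed
  then show ?thesis by blast
qed

section \<open>Classification of the height one monomial primes containing t\<close>

definition forms :: "(expo \<Rightarrow> int) set" where
  "forms = vertex_form ` {1..n} \<union> block_form ` \<B>"

definition form_ideal :: "(expo \<Rightarrow> int) \<Rightarrow> 'k::field mpoly poly set" where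
  "form_ideal l = supported {h \<in> H. 0 < l h}"

lemma forms_nonneg: "l \<in> forms \<Longrightarrow> nonneg_form l"
  by (auto simp: forms_def nonneg_vertex_form nonneg_block_form)

lemma forms_facet: "l \<in> forms \<Longrightarrow> \<exists>u w. facet_form H l u w"
  unfolding forms_def using facet_form_vertex facet_form_block by blast

text \<open>Otherwise some monomial outside \<open>P\<close> lies so deep inside the cone that it
  remains in \<open>H\<close> after division by t; being a multiple of t, it would belong to
  \<open>P\<close>.\<close>

lemma prime_contains_form_ideal:
  assumes P: "primeideal P (supported_ring H :: 'k::field mpoly poly ring)" and t: "xFt {} \<in> P"
  shows "\<exists>l\<in>forms. form_ideal l \<subseteq> P"
proof (rule ccontr)
  assume neg: "\<not> ?thesis"
  interpret P: primeideal P "supported_ring H :: 'k mpoly poly ring" by (rule P)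
  have "finite forms" by (simp add: forms_def finite_blocks)
  \<comment> \<open>Division by t lowers vertex forms by 1 and block forms by \<open>d - 1\<close>,
    so the bound \<open>d\<close> is ample for both.\<close>
  then obtain h where h: "h \<in> H" "mterm 1 h \<notin> P" and big: "\<And>l. l \<in> forms \<Longrightarrow> int d \<le> l h"
    using prime_avoiding_monomial[OF P _ forms_nonneg, of forms d] neg unfolding form_ideal_def by blast
  have v: "Poly_Mapping.lookup (fst h) i < snd h" if "i \<in> {1..n}" for i
    using big[of "vertex_form i"] that d by (auto simp: forms_def vertex_form_def)
  \<comment> \<open>As \<open>1 \<le> n\<close>, there is a vertex, and its strict inequality makes
    the degree positive.\<close>
  then obtain k where k: "snd h = Suc k"
    using n by (metis atLeastAtMost_iff le_refl less_imp_Suc_add)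
  have "Poly_Mapping.lookup (fst h) i \<le> k" for i
  proof (cases "i \<in> {1..n}")
    case True
    then show ?thesis using v[of i] k by simp
  next
    case False
    then have "i \<notin> Poly_Mapping.keys (fst h)" using h by (auto simp: H_def)
    then show ?thesis by (simp add: in_keys_iff)
  qed
  moreover have "(\<Sum>i\<in>C. Poly_Mapping.lookup (fst h) i) \<le> (d - 1) * k" if "C \<in> \<B>" for C
  proof -
    have "int d \<le> block_form C h" using big that by (simp add: forms_def)
    then have "d + (\<Sum>i\<in>C. Poly_Mapping.lookup (fst h) i) \<le> (d - 1) * snd h"
      unfolding block_form_def by linarith
    then show ?thesis by (simp add: k)
  qed
  ultimately have h': "(fst h, k) \<in> H" using h(1) by (simp add: H_def)
  have "h = face_expo {} + (fst h, k)" by (simp add: prod_eq_iff k face_expo_def)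
  then have "(mterm 1 h :: 'k mpoly poly) = xFt {} * mterm 1 (fst h, k)"
    by (simp add: xFt_eq_mterm mterm_mult flip: prod_eq_iff)
  then show False
    using P.I_r_closed[OF t, of "mterm 1 (fst h, k)"] h(2) by (simp add: mterm_supported h')
qed

lemma form_ideal_prime:
  assumes "l \<in> forms"
  shows "primeideal (form_ideal l) (supported_ring H :: 'k::field mpoly poly ring)"
    and "(form_ideal l :: 'k mpoly poly set) \<noteq> {0}"
    and "primeideal Q (supported_ring H :: 'k mpoly poly ring) \<Longrightarrow> Q \<subseteq> form_ideal l \<Longrightarrow> Q \<noteq> {0} \<Longrightarrow>
      Q = form_ideal l"
proof -
  obtain u w where "facet_form H l u w" using forms_facet[OF assms] by blast
  then interpret F: facet_form H l u w .
  have eq: "form_ideal l = (F.facet_ideal :: 'k mpoly poly set)"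
    by (simp add: form_ideal_def F.facet_ideal_def)
  show "primeideal (form_ideal l) (supported_ring H :: 'k mpoly poly ring)"
    unfolding eq by (rule F.primeideal_facet_ideal)
  show "(form_ideal l :: 'k mpoly poly set) \<noteq> {0}"
    unfolding eq by (rule F.facet_ideal_nonzero)
  show "primeideal Q (supported_ring H :: 'k mpoly poly ring) \<Longrightarrow> Q \<subseteq> form_ideal l \<Longrightarrow> Q \<noteq> {0} \<Longrightarrow>
      Q = form_ideal l"
    unfolding eq by (rule F.facet_ideal_minimal)
qed

lemma primeideal_zero: "primeideal {0} (supported_ring H :: 'k::field mpoly poly ring)"
  using domain.zeroprimeideal[OF domain_supported] by simp

lemma zero_in_primeideal:
  "primeideal Q (supported_ring H :: 'k::field mpoly poly ring) \<Longrightarrow> {0} \<subseteq> Q"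
proof -
  assume "primeideal Q (supported_ring H :: 'k mpoly poly ring)"
  then have "\<zero>\<^bsub>supported_ring H\<^esub> \<in> Q"
    by (intro additive_subgroup.zero_closed[OF ideal.axioms(1)[OF primeideal.axioms(1)]])
  then show ?thesis by simp
qed

text \<open>A height one prime containing t contains a nonzero prime \<open>form_ideal l\<close>, so
  the two coincide. Conversely, \<open>facet_ideal_minimal\<close> leaves only {0} strictly below a
  form ideal.\<close>

lemma height_one_monomial_primes_eq:
  "height_one_monomial_primes n \<Gamma> = (form_ideal ` forms :: 'k::field mpoly poly set set)"
proof (intro equalityI subsetI)
  let ?R = "supported_ring H :: 'k mpoly poly ring"
  fix P :: "'k mpoly poly set" assume "P \<in> height_one_monomial_primes n \<Gamma>"
  then have P: "primeideal P ?R" "height ?R P = 1" "xFt {} \<in> P"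
    by (simp_all add: height_one_monomial_primes_def toric_ring_eq)
  obtain l where l: "l \<in> forms" "form_ideal l \<subseteq> P" using prime_contains_form_ideal[OF P(1,3)] by blast
  have "{0} \<subset> (form_ideal l :: 'k mpoly poly set)"
    using zero_in_primeideal[OF form_ideal_prime(1)[OF l(1)]] form_ideal_prime(2)[OF l(1)] by blast
  then have "form_ideal l = P"
    using height_eq_1D[OF P(2,1) primeideal_zero form_ideal_prime(1)[OF l(1)]] l(2) by blast
  then show "P \<in> form_ideal ` forms" using l(1) by blast
next
  let ?R = "supported_ring H :: 'k mpoly poly ring"
  fix P :: "'k mpoly poly set" assume "P \<in> form_ideal ` forms"
  then obtain l where l: "l \<in> forms" and P: "P = form_ideal l" by blast
  have pr: "primeideal P ?R" "P \<noteq> {0}"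
    "primeideal Q ?R \<Longrightarrow> Q \<subseteq> P \<Longrightarrow> Q \<noteq> {0} \<Longrightarrow> Q = P" for Q
    unfolding P
    by (rule form_ideal_prime(1)[OF l], rule form_ideal_prime(2)[OF l], rule form_ideal_prime(3)[OF l])
  have "height ?R P = 1"
  proof (rule height_eq_1I[OF primeideal_zero pr(1) _ zero_in_primeideal])
    show "{0} \<subset> P" using zero_in_primeideal[OF pr(1)] pr(2) by blast
  qed (assumption, rule pr(3))
  moreover have "P = Idl\<^bsub>?R\<^esub> {xFt F | F. F \<in> \<Gamma> \<and> 0 < l (face_expo F)}"
    unfolding P form_ideal_def by (rule supported_eq_genideal[OF forms_nonneg[OF l]])
  moreover have "{xFt F | F. F \<in> \<Gamma> \<and> 0 < l (face_expo F)} \<subseteq> (monomials n \<inter> supported H :: 'k mpoly poly set)"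
    using xFt_supported xFt_in_monomials by (auto simp: \<Gamma>_def)
  then have "\<exists>M \<subseteq> monomials n \<inter> supported H. P = Idl\<^bsub>?R\<^esub> M"
    using \<open>P = Idl\<^bsub>?R\<^esub> _\<close> by blast
  then have "monomial_ideal n \<Gamma> P"
    unfolding monomial_ideal_def toric_ring_eq by simp
  \<comment> \<open>At the exponent of t, vertex forms take the value 1 and block forms
    \<open>d - 1\<close>.\<close>
  moreover have "0 < l (face_expo {})"
    using l vertex_form_face[OF empty_face] block_form_face[OF empty_face] d by (auto simp: forms_def)
  then have "xFt {} \<in> P"
    unfolding P form_ideal_def xFt_eq_mterm[OF finite.emptyI]
    by (intro mterm_supported) (simp add: face_expo_in_H[OF empty_face])
  ultimately show "P \<in> height_one_monomial_primes n \<Gamma>"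
    using pr(1) by (simp add: height_one_monomial_primes_def toric_ring_eq)
qed

lemma form_ideal_vertex: "form_ideal (vertex_form i) = P_ideal \<Gamma> i"
proof -
  have "F \<in> \<Gamma> \<and> 0 < vertex_form i (face_expo F) \<longleftrightarrow> F \<in> \<Gamma> \<and> i \<notin> F" for F
    using vertex_form_face by blast
  then show ?thesis
    by (simp only: form_ideal_def P_ideal_def supported_eq_genideal[OF nonneg_vertex_form] toric_ring_eq)
qed

lemma form_ideal_block:
  assumes "C \<in> \<B>"
  shows "form_ideal (block_form C) = L_ideal \<Gamma> d C"
proof -
  have "F \<in> \<Gamma> \<and> 0 < block_form C (face_expo F) \<longleftrightarrow> F \<in> \<Gamma> \<and> card (F \<inter> C) < d - 1" for F
    using block_form_face[OF _ assms] by blast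
  then show ?thesis
    by (simp only: form_ideal_def L_ideal_def supported_eq_genideal[OF nonneg_block_form[OF assms]]
        toric_ring_eq)
qed

end

section \<open>Maximal cliques of unit-interval complexes\<close>

lemma facet_card:
  assumes "unit_interval_complex n d \<Delta>" "F \<in> facets \<Delta>"
  shows "card F = d" "F \<subseteq> {1..n}"
  using assms by (auto simp: unit_interval_complex_def pure_complex_def simplicial_complex_def facets_def)

text \<open>There are finitely many cliques above \<open>C\<close>, and one maximal among them is
  maximal among all cliques.\<close>

lemma clique_in_maximal_clique:
  assumes "is_clique n d \<Delta> C" "d \<le> card C"
  shows "\<exists>C'\<in>maximal_cliques n d \<Delta>. C \<subseteq> C'"
proof -
  let ?A = "{C'. is_clique n d \<Delta> C' \<and> C \<subseteq> C'}"
  have "?A \<subseteq> Pow {1..n}" by (auto simp: is_clique_def)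
  then have fin: "finite ?A" by (rule finite_subset) simp
  then obtain M where M: "M \<in> ?A" "\<forall>C'\<in>?A. M \<subseteq> C' \<longrightarrow> M = C'"
    using finite_has_maximal[OF fin] assms by blast
  have "finite M" using M(1) by (auto simp: is_clique_def intro: finite_subset)
  then have "d \<le> card M" using assms(2) M(1) card_mono[of M C] by auto
  then have "M \<in> maximal_cliques n d \<Delta>" using M by (auto simp: maximal_cliques_def)
  then show ?thesis using M(1) by blast
qed

text \<open>The facets are exactly the \<open>d\<close>-subsets of maximal cliques: a facet is
  itself a clique, having only itself as a \<open>d\<close>-subset, and so extends to a maximal
  one.\<close>

lemma Ind_eq:
  assumes "unit_interval_complex n d \<Delta>"
  shows "Ind n \<Delta> = {A. A \<subseteq> {1..n} \<and> (\<forall>C\<in>maximal_cliques n d \<Delta>. card (A \<inter> C) < d)}"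
proof (intro equalityI subsetI)
  fix A assume A: "A \<in> Ind n \<Delta>"
  have "card (A \<inter> C) < d" if C: "C \<in> maximal_cliques n d \<Delta>" for C
  proof (rule ccontr)
    assume "\<not> ?thesis"
    then have "d \<le> card (A \<inter> C)" by simp
    then obtain F where F: "F \<subseteq> A \<inter> C" "card F = d"
      using obtain_subset_with_card_n by blast
    have "is_clique n d \<Delta> C" using C by (simp add: maximal_cliques_def)
    then have "F \<in> facets \<Delta>" using F unfolding is_clique_def by blast
    then show False using A F(1) unfolding Ind_def by blast
  qed
  then show "A \<in> {A. A \<subseteq> {1..n} \<and> (\<forall>C\<in>maximal_cliques n d \<Delta>. card (A \<inter> C) < d)}"
    using A unfolding Ind_def by blast
next
  fix A assume A: "A \<in> {A. A \<subseteq> {1..n} \<and> (\<forall>C\<in>maximal_cliques n d \<Delta>. card (A \<inter> C) < d)}"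
  have False if F: "F \<in> facets \<Delta>" "F \<subseteq> A" for F
  proof -
    note Fd = facet_card[OF assms F(1)]
    have "finite F" using Fd(2) by (rule finite_subset) simp
    then have "G = F" if "G \<subseteq> F" "card G = d" for G
      using card_subset_eq[of F G] that Fd(1) by simp
    then have "is_clique n d \<Delta> F" using F(1) Fd(2) unfolding is_clique_def by blast
    then obtain C where C: "C \<in> maximal_cliques n d \<Delta>" "F \<subseteq> C"
      using clique_in_maximal_clique[of n d \<Delta> F] Fd(1) by auto
    have "finite (A \<inter> C)" using A finite_subset[of A "{1..n}"] by simp
    then have "card F \<le> card (A \<inter> C)" using F C by (intro card_mono) auto
    moreover have "card (A \<inter> C) < d" using A C(1) by blast
    ultimately show False using Fd(1) by simp
  qed
  then show "A \<in> Ind n \<Delta>" using A unfolding Ind_def by blast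
qed

text \<open>Without vertices only the complex {{}} remains, of dimension -1, which forces d =
  0.\<close>

lemma dim_vertices_pos:
  assumes "unit_interval_complex n d \<Delta>" "1 \<le> d"
  shows "1 \<le> n"
proof (rule ccontr)
  assume "\<not> 1 \<le> n"
  then have "\<Delta> = {{}}"
    using assms(1) by (auto simp: unit_interval_complex_def simplicial_complex_def)
  then have "complex_dim \<Delta> = -1" by (simp add: complex_dim_def)
  then show False using assms by (simp add: unit_interval_complex_def)
qed

theorem proposition3p4:
  fixes n d m :: nat and \<Delta> \<Gamma> :: "nat set set" and B :: "nat \<Rightarrow> nat set"
  assumes "unit_interval_complex n d \<Delta>"
    and "int d - 1 > 1"
    and "\<Gamma> = Ind n \<Delta>"
    and "bij_betw B {1..m} (maximal_cliques n d \<Delta>)"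
    and "partition_on {1..n} (maximal_cliques n d \<Delta>)"
  shows "(height_one_monomial_primes n \<Gamma> :: 'k::field mpoly poly set set) =
           {P_ideal \<Gamma> i | i. i \<in> {1..n}} \<union> {L_ideal \<Gamma> d (B j) | j. j \<in> {1..m}}"
proof -
  interpret T: partition_toric n d "maximal_cliques n d \<Delta>"
    using assms(2,5) dim_vertices_pos[OF assms(1)]
    by unfold_locales (auto simp: maximal_cliques_def)
  have \<Gamma>: "\<Gamma> = T.\<Gamma>" by (simp add: assms(3) Ind_eq[OF assms(1)] T.\<Gamma>_def)
  have "(height_one_monomial_primes n \<Gamma> :: 'k mpoly poly set set) =
      P_ideal \<Gamma> ` {1..n} \<union> L_ideal \<Gamma> d ` maximal_cliques n d \<Delta>"
    by (simp add: \<Gamma> T.height_one_monomial_primes_eq T.forms_def image_Un image_image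
        T.form_ideal_vertex T.form_ideal_block)
  also have "maximal_cliques n d \<Delta> = B ` {1..m}"
    using assms(4) by (simp add: bij_betw_def)
  finally show ?thesis by auto
qed

end
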